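(* Let $R$ be a commutative ring, $N$ a nilpotent ideal of index $k$ in $R$, $G$ a commutative group, and $s$ the characteristic of the quotient ring $R/N$. If $f\in RG$ is such that $f+NG$ is an idempotent element in the group ring $(R/N)G$, then $$f^{s^{k-1}}$$ is an idempotent element in the group ring $RG$. Furthermore, $|E(RG)|=|E((R/N)G)|$.
   Context: Rings have an identity. For a commutative ring $A$, $E(A)=\{e\in A : e^2=e\}$ denotes its set of idempotent elements, and $|X|$ denotes the cardinality of a set $X$. The (nilpotency) index of a nilpotent ideal $N$ is the least positive integer $k$ with $N^k=0$, where $N^k$ is the ideal generated by all products of $k$ elements of $N$. $RG$ denotes the group ring of $G$ over $R$; $NG$ is the ideal of $RG$ consisting of the elements all of whose coefficients lie in $N$. The quotient $RG/NG$ is identified with $(R/N)G$ by reducing coefficients modulo $N$, and $f+NG$ is regarded as an element of $(R/N)G$ in this way. *)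

theory Defs
  imports "HOL-Algebra.QuotRing" "HOL-Library.Equipollence"
begin

definition idempotents :: "('a, 'm) monoid_scheme \<Rightarrow> 'a set" where
  "idempotents A = {e \<in> carrier A. e \<otimes>\<^bsub>A\<^esub> e = e}"

text \<open>The value is 0 when no positive multiple of the identity vanishes, and 1 for the zero ring.\<close>

definition ring_characteristic :: "('a, 'm) ring_scheme \<Rightarrow> nat" where
  "ring_characteristic A =
     (if \<exists>n::nat. 0 < n \<and> [n] \<cdot>\<^bsub>A\<^esub> \<one>\<^bsub>A\<^esub> = \<zero>\<^bsub>A\<^esub>
      then LEAST n::nat. 0 < n \<and> [n] \<cdot>\<^bsub>A\<^esub> \<one>\<^bsub>A\<^esub> = \<zero>\<^bsub>A\<^esub>
      else 0)"

definition ideal_power :: "('a, 'm) ring_scheme \<Rightarrow> 'a set \<Rightarrow> nat \<Rightarrow> 'a set" where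
  "ideal_power R N k = Idl\<^bsub>R\<^esub> {(\<Otimes>\<^bsub>R\<^esub>i\<in>{..<k}. x i) |x. x \<in> {..<k} \<rightarrow> N}"

definition nilpotent_of_index :: "('a, 'm) ring_scheme \<Rightarrow> 'a set \<Rightarrow> nat \<Rightarrow> bool" where
  "nilpotent_of_index R N k \<longleftrightarrow>
     0 < k \<and> ideal_power R N k = {\<zero>\<^bsub>R\<^esub>} \<and>
     (\<forall>j. 0 < j \<and> j < k \<longrightarrow> ideal_power R N j \<noteq> {\<zero>\<^bsub>R\<^esub>})"

definition gr_support ::
  "('a, 'm) ring_scheme \<Rightarrow> ('g, 'n) monoid_scheme \<Rightarrow> ('g \<Rightarrow> 'a) \<Rightarrow> 'g set" where
  "gr_support R G f = {g \<in> carrier G. f g \<noteq> \<zero>\<^bsub>R\<^esub>}"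

text \<open>
  The formal sum of the \<open>f g\<close> times \<open>g\<close> is encoded by its coefficient function \<open>f\<close>, taken to be
  undefined outside the carrier of \<open>G\<close> so that equality of elements is equality of functions.
  The coefficient of a product at \<open>g\<close> is the sum of the \<open>f x\<close> times \<open>h y\<close> over all \<open>x\<close>, \<open>y\<close> with
  product \<open>g\<close>, that is with \<open>y\<close> equal to the inverse of \<open>x\<close> times \<open>g\<close>; only the finitely many \<open>x\<close>
  in the support of \<open>f\<close> contribute.
\<close>

definition group_ring ::
  "('a, 'm) ring_scheme \<Rightarrow> ('g, 'n) monoid_scheme \<Rightarrow> ('g \<Rightarrow> 'a) ring" where
  "group_ring R G =
     \<lparr>carrier = {f \<in> carrier G \<rightarrow>\<^sub>E carrier R. finite (gr_support R G f)},
      mult = (\<lambda>f h. \<lambda>g\<in>carrier G.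
        \<Oplus>\<^bsub>R\<^esub>x\<in>gr_support R G f. f x \<otimes>\<^bsub>R\<^esub> h (inv\<^bsub>G\<^esub> x \<otimes>\<^bsub>G\<^esub> g)),
      one = (\<lambda>g\<in>carrier G. if g = \<one>\<^bsub>G\<^esub> then \<one>\<^bsub>R\<^esub> else \<zero>\<^bsub>R\<^esub>),
      zero = (\<lambda>g\<in>carrier G. \<zero>\<^bsub>R\<^esub>),
      add = (\<lambda>f h. \<lambda>g\<in>carrier G. f g \<oplus>\<^bsub>R\<^esub> h g)\<rparr>"

definition coeff_ideal ::
  "('a, 'm) ring_scheme \<Rightarrow> ('g, 'n) monoid_scheme \<Rightarrow> 'a set \<Rightarrow> ('g \<Rightarrow> 'a) set" where
  "coeff_ideal R G N = {f \<in> carrier (group_ring R G). \<forall>g\<in>carrier G. f g \<in> N}"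

text \<open>
  The image of \<open>f\<close> in the group ring over \<open>R Quot N\<close>. This is the class of \<open>f\<close> modulo
  \<open>coeff_ideal R G N\<close>, under the usual identification of the quotient of the group ring by that
  ideal with the group ring over the quotient; the kernel is computed below.
\<close>

definition reduce_coeffs ::
  "('a, 'm) ring_scheme \<Rightarrow> ('g, 'n) monoid_scheme \<Rightarrow> 'a set \<Rightarrow> ('g \<Rightarrow> 'a) \<Rightarrow> 'g \<Rightarrow> 'a set" where
  "reduce_coeffs R G N f = (\<lambda>g\<in>carrier G. N +>\<^bsub>R\<^esub> f g)"

lemma kernel_reduce_coeffs:
  assumes "ideal N R"
  shows "a_kernel (group_ring R G) (group_ring (R Quot N) G) (reduce_coeffs R G N)
         = coeff_ideal R G N"
proof -
  interpret ideal N R by fact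
  have *: "N +>\<^bsub>R\<^esub> a = N \<longleftrightarrow> a \<in> N" if "a \<in> carrier R" for a
    using that a_coset_join1 a_coset_join2 additive_subgroup.a_subgroup[OF is_additive_subgroup]
    by blast
  have z: "\<zero>\<^bsub>R Quot N\<^esub> = N"
    by (simp add: FactRing_def)
  have "reduce_coeffs R G N f = (\<lambda>g\<in>carrier G. N) \<longleftrightarrow> (\<forall>g\<in>carrier G. f g \<in> N)"
    if "f \<in> carrier (group_ring R G)" for f
  proof -
    have c: "f g \<in> carrier R" if "g \<in> carrier G" for g
      using \<open>f \<in> _\<close> that by (auto simp: group_ring_def)
    have "reduce_coeffs R G N f = (\<lambda>g\<in>carrier G. N)
            \<longleftrightarrow> (\<forall>g\<in>carrier G. N +>\<^bsub>R\<^esub> f g = N)"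
      by (auto simp: reduce_coeffs_def fun_eq_iff restrict_def)
    with * c show ?thesis by auto
  qed
  then show ?thesis
    by (auto simp: a_kernel_def' coeff_ideal_def) (auto simp: group_ring_def z)
qed

end

theory Submission
  imports Defs
begin

text \<open>
  Put \<open>M = NG\<close>, the kernel of the reduction of coefficients. Coefficients of a product of \<open>k\<close> elements
  of \<open>M\<close> are sums of products of \<open>k\<close> elements of \<open>N\<close>, so \<open>M ^ k = 0\<close> (\<open>coeff_ideal_nilpotent\<close>). Since
  \<open>s\<close> is the characteristic of \<open>R/N\<close>, the element \<open>s \<cdot> 1\<close> lies in \<open>N\<close>, hence in \<open>M\<close>. Everything else
  is a statement about a commutative ring with an ideal \<open>M\<close> such that \<open>M ^ k = 0\<close> and \<open>s \<cdot> 1\<close> is in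
  \<open>M\<close>.

  For the first claim, if \<open>a - b\<close> is in \<open>M ^ i\<close> with \<open>i \<ge> 1\<close>, then
  \<open>a ^ s - b ^ s = s (a - b) b ^ (s - 1) + (a - b) ^ 2 (\<dots>)\<close> is in \<open>M ^ (i + 1)\<close>: in the first term the
  factor \<open>s\<close> contributes an element of \<open>M\<close>, in the second the additional factor \<open>a - b\<close> does
  (\<open>pow_char_diff_mem_ideal_power\<close>). Starting from \<open>a = f ^ 2\<close> and \<open>b = f\<close>, which are congruent modulo
  \<open>M\<close>, and taking \<open>s\<close>-th powers \<open>k - 1\<close> times gives equality of \<open>f ^ s ^ (k - 1)\<close> with its square. When
  the characteristic is \<open>0\<close> the same argument applies: \<open>0 \<cdot> 1\<close> is in \<open>M\<close>, and the power is \<open>1\<close>, or \<open>f\<close>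
  itself if \<open>k = 1\<close>.

  For the second claim, reduction of coefficients is surjective with nil kernel, and such a homomorphism
  restricts to a bijection between the idempotents (\<open>bij_betw_idempotents_of_nil_kernel\<close>). In
  characteristic \<open>0\<close> the power from the first claim is \<open>1\<close> as soon as \<open>k > 1\<close> and lifts nothing else, so
  for surjectivity an idempotent is lifted by the polynomial \<open>1 - (1 - f ^ n) ^ n\<close>.
\<close>

section \<open>Powers of an ideal\<close>

lemma (in ring) eq_of_diff_eq_zero:
  assumes "a \<in> carrier R" "b \<in> carrier R" "a \<ominus> b = \<zero>"
  shows "a = b"
proof -
  have "a = (a \<ominus> b) \<oplus> b" using assms(1,2) by (simp add: a_minus_def a_assoc l_neg)
  then show ?thesis using assms by simp
qed

lemma (in cring) ideal_power_is_ideal: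
  assumes "ideal N R" shows "ideal (ideal_power R N i) R"
proof -
  interpret N: ideal N R by fact
  show ?thesis unfolding ideal_power_def
    by (rule genideal_ideal) (auto intro!: finprod_closed dest: N.Icarr)
qed

lemma (in cring) finprod_mem_ideal_power:
  assumes "ideal N R" "x \<in> {..<i} \<rightarrow> N"
  shows "(\<Otimes>j\<in>{..<i}. x j) \<in> ideal_power R N i"
proof -
  interpret N: ideal N R by fact
  have "{(\<Otimes>j\<in>{..<i}. x j) |x. x \<in> {..<i} \<rightarrow> N} \<subseteq> carrier R"
    by (auto intro!: finprod_closed dest: N.Icarr)
  from genideal_self[OF this] show ?thesis
    using assms(2) unfolding ideal_power_def by blast
qed

lemma (in cring) ideal_power_minimal:
  assumes "ideal J R" and "\<And>x. x \<in> {..<i} \<rightarrow> N \<Longrightarrow> (\<Otimes>j\<in>{..<i}. x j) \<in> J"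
  shows "ideal_power R N i \<subseteq> J"
  unfolding ideal_power_def by (rule genideal_minimal[OF assms(1)]) (use assms(2) in blast)

lemma (in cring) finprod_lessThan_Suc:
  assumes "x \<in> {..<Suc i} \<rightarrow> carrier R"
  shows "(\<Otimes>j\<in>{..<Suc i}. x j) = x i \<otimes> (\<Otimes>j\<in>{..<i}. x j)"
proof -
  have "{..<Suc i} = insert i {..<i}" by auto
  then show ?thesis using assms by (simp add: Pi_def)
qed

text \<open>
  The elements \<open>b\<close> whose product with \<open>a\<close> falls into the next power form an ideal, so it is enough to
  look at the generators of \<open>ideal_power R N i\<close>, where \<open>a\<close> is appended as the last factor.
\<close>

lemma (in cring) mult_mem_ideal_power_Suc:
  assumes N: "ideal N R" and a: "a \<in> N" and b: "b \<in> ideal_power R N i"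
  shows "a \<otimes> b \<in> ideal_power R N (Suc i)"
proof -
  interpret N: ideal N R by fact
  interpret P: ideal "ideal_power R N (Suc i)" R by (rule ideal_power_is_ideal[OF N])
  have aR: "a \<in> carrier R" using a N.Icarr by blast
  let ?J = "{b \<in> carrier R. a \<otimes> b \<in> ideal_power R N (Suc i)}"
  have "ideal ?J R"
  proof (rule idealI)
    show "ring R" by (rule ring_axioms)
    show "subgroup ?J (add_monoid R)"
      using aR P.a_closed P.zero_closed P.a_inv_closed
      by (intro add.subgroupI) (auto simp: r_distr r_minus)
    fix x y assume "x \<in> ?J" "y \<in> carrier R"
    then show "x \<otimes> y \<in> ?J" using aR P.I_r_closed[of "a \<otimes> x" y] by (auto simp: m_assoc)
    with \<open>x \<in> ?J\<close> \<open>y \<in> carrier R\<close> show "y \<otimes> x \<in> ?J" by (simp add: m_comm)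
  qed
  moreover have "(\<Otimes>j\<in>{..<i}. x j) \<in> ?J" if x: "x \<in> {..<i} \<rightarrow> N" for x
  proof -
    have xR: "x \<in> {..<i} \<rightarrow> carrier R" using x N.Icarr by (auto simp: Pi_iff)
    let ?y = "\<lambda>j. if j < i then x j else a"
    have "(\<Otimes>j\<in>{..<Suc i}. ?y j) \<in> ideal_power R N (Suc i)"
      using x a by (intro finprod_mem_ideal_power[OF N]) auto
    moreover have "(\<Otimes>j\<in>{..<Suc i}. ?y j) = a \<otimes> (\<Otimes>j\<in>{..<i}. ?y j)"
      using xR aR by (subst finprod_lessThan_Suc) auto
    moreover have "(\<Otimes>j\<in>{..<i}. ?y j) = (\<Otimes>j\<in>{..<i}. x j)"
      using xR by (intro finprod_cong') auto
    ultimately show ?thesis using xR by simp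
  qed
  ultimately have "ideal_power R N i \<subseteq> ?J" by (rule ideal_power_minimal)
  then show ?thesis using b by blast
qed

lemma (in cring) ideal_subset_ideal_power_one:
  assumes N: "ideal N R" shows "N \<subseteq> ideal_power R N (Suc 0)"
proof
  fix a assume a: "a \<in> N"
  then have "a \<in> carrier R" using ideal.Icarr[OF N] by blast
  then show "a \<in> ideal_power R N (Suc 0)"
    using finprod_mem_ideal_power[OF N, of "\<lambda>_. a" "Suc 0"] a by (simp add: finprod_lessThan_Suc)
qed

lemma (in cring) ideal_power_Suc_subset_ideal:
  assumes N: "ideal N R" shows "ideal_power R N (Suc i) \<subseteq> N"
proof (rule ideal_power_minimal[OF N])
  interpret N: ideal N R by fact
  fix x assume x: "x \<in> {..<Suc i} \<rightarrow> N"
  then have "x \<in> {..<Suc i} \<rightarrow> carrier R" using N.Icarr by (auto simp: Pi_iff)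
  then show "(\<Otimes>j\<in>{..<Suc i}. x j) \<in> N"
    using x by (auto simp: finprod_lessThan_Suc Pi_iff intro!: N.I_r_closed finprod_closed)
qed

lemma (in cring) pow_mem_ideal_power:
  assumes N: "ideal N R" and a: "a \<in> N"
  shows "a [^] i \<in> ideal_power R N i"
  using finprod_mem_ideal_power[OF N, of "\<lambda>_. a" i] a ideal.Icarr[OF N]
  by (simp add: finprod_const)

section \<open>Powers of congruent elements\<close>

lemma (in cring) pow_diff_mem_ideal:
  fixes n :: nat
  assumes J: "ideal J R"
    and a: "a \<in> carrier R" and b: "b \<in> carrier R" and ab: "a \<ominus> b \<in> J"
  shows "a [^] n \<ominus> b [^] n \<in> J"
proof -
  interpret J: ideal J R by fact
  show ?thesis
  proof (induction n)
    case 0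
    then show ?case by (simp add: a_minus_def r_neg)
  next
    case (Suc n)
    have "a [^] Suc n \<ominus> b [^] Suc n = a \<otimes> (a [^] n \<ominus> b [^] n) \<oplus> (a \<ominus> b) \<otimes> b [^] n"
      using a b nat_pow_closed[OF a, of n] nat_pow_closed[OF b, of n]
      unfolding nat_pow_Suc by algebra
    then show ?case using Suc a b ab
      by (simp add: J.I_l_closed J.I_r_closed)
  qed
qed

text \<open>
  This is the binomial expansion of \<open>(b + (a - b)) ^ Suc n\<close> to first order; the ideal \<open>K\<close> absorbs
  products of two elements of \<open>J\<close>. The error term satisfies a recursion whose only new contribution is the product of
  \<open>a ^ Suc n - b ^ Suc n\<close> with \<open>a - b\<close>, both in \<open>J\<close>.
\<close>

lemma (in cring) pow_first_order_expansion:
  fixes n :: nat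
  assumes J: "ideal J R" and K: "ideal K R" and JJ: "\<And>x y. x \<in> J \<Longrightarrow> y \<in> J \<Longrightarrow> x \<otimes> y \<in> K"
    and a: "a \<in> carrier R" and b: "b \<in> carrier R" and ab: "a \<ominus> b \<in> J"
  shows "a [^] Suc n \<ominus> b [^] Suc n \<ominus> [Suc n] \<cdot> \<one> \<otimes> ((a \<ominus> b) \<otimes> b [^] n) \<in> K"
proof -
  interpret K: ideal K R by fact
  show ?thesis
  proof (induction n)
    case 0
    then show ?case using a b by (simp add: a_minus_def r_neg)
  next
    case (Suc n)
    have t: "[Suc n] \<cdot> \<one> \<in> carrier R" by simp
    have t': "[Suc (Suc n)] \<cdot> \<one> = [Suc n] \<cdot> \<one> \<oplus> \<one>" by simp
    have p: "a [^] Suc (Suc n) = a [^] Suc n \<otimes> a" "b [^] Suc (Suc n) = b [^] Suc n \<otimes> b"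
      "b [^] Suc n = b [^] n \<otimes> b" by simp_all
    let ?X = "a [^] Suc n \<ominus> b [^] Suc n \<ominus> [Suc n] \<cdot> \<one> \<otimes> ((a \<ominus> b) \<otimes> b [^] n)"
    have "a [^] Suc (Suc n) \<ominus> b [^] Suc (Suc n) \<ominus> [Suc (Suc n)] \<cdot> \<one> \<otimes> ((a \<ominus> b) \<otimes> b [^] Suc n)
       = b \<otimes> ?X \<oplus> (a [^] Suc n \<ominus> b [^] Suc n) \<otimes> (a \<ominus> b)"
      using a b nat_pow_closed[OF a, of "Suc n"] nat_pow_closed[OF b, of n] t
      unfolding p t' by algebra
    moreover have "(a [^] Suc n \<ominus> b [^] Suc n) \<otimes> (a \<ominus> b) \<in> K"
      using JJ pow_diff_mem_ideal[OF J a b ab] ab by blast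
    ultimately show ?case using Suc b by (simp add: K.I_l_closed del: nat_pow_Suc)
  qed
qed

text \<open>
  Raising a congruence to the \<open>s\<close>-th power improves it by one power of \<open>M\<close>: to first order the
  difference of the powers is \<open>s\<close> times a multiple of \<open>a - b\<close>, and \<open>s \<cdot> 1\<close> is in \<open>M\<close>. For
  \<open>s = 0\<close> both powers are \<open>1\<close>.
\<close>

lemma (in cring) pow_char_diff_mem_ideal_power:
  fixes s :: nat
  assumes M: "ideal M R" and s: "[s] \<cdot> \<one> \<in> M"
    and a: "a \<in> carrier R" and b: "b \<in> carrier R" and ab: "a \<ominus> b \<in> ideal_power R M (Suc i)"
  shows "a [^] s \<ominus> b [^] s \<in> ideal_power R M (Suc (Suc i))"
proof (cases s)
  case 0
  interpret K: ideal "ideal_power R M (Suc (Suc i))" R by (rule ideal_power_is_ideal[OF M])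
  show ?thesis using 0 by (simp add: a_minus_def r_neg K.zero_closed)
next
  case (Suc n)
  interpret J: ideal "ideal_power R M (Suc i)" R by (rule ideal_power_is_ideal[OF M])
  interpret K: ideal "ideal_power R M (Suc (Suc i))" R by (rule ideal_power_is_ideal[OF M])
  have 1: "a [^] s \<ominus> b [^] s \<ominus> [s] \<cdot> \<one> \<otimes> ((a \<ominus> b) \<otimes> b [^] n) \<in> ideal_power R M (Suc (Suc i))"
    unfolding Suc
  proof (rule pow_first_order_expansion[OF J.is_ideal K.is_ideal _ a b ab])
    fix x y assume "x \<in> ideal_power R M (Suc i)" "y \<in> ideal_power R M (Suc i)"
    then show "x \<otimes> y \<in> ideal_power R M (Suc (Suc i))"
      using ideal_power_Suc_subset_ideal[OF M] mult_mem_ideal_power_Suc[OF M] by blast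
  qed
  have 2: "[s] \<cdot> \<one> \<otimes> ((a \<ominus> b) \<otimes> b [^] n) \<in> ideal_power R M (Suc (Suc i))"
    using mult_mem_ideal_power_Suc[OF M s] ab b J.I_r_closed by simp
  have "a [^] s \<ominus> b [^] s = (a [^] s \<ominus> b [^] s \<ominus> [s] \<cdot> \<one> \<otimes> ((a \<ominus> b) \<otimes> b [^] n)) 
     \<oplus> [s] \<cdot> \<one> \<otimes> ((a \<ominus> b) \<otimes> b [^] n)"
    using nat_pow_closed[OF a, of s] nat_pow_closed[OF b, of s] nat_pow_closed[OF b, of n] a b
      K.Icarr[OF 2] by algebra
  with K.a_closed[OF 1 2] show ?thesis by simp
qed

text \<open>
  Start from the congruence of \<open>f ^ 2\<close> and \<open>f\<close> modulo \<open>M\<close> and improve it \<open>k - 1\<close> times; the result is a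
  congruence modulo \<open>M ^ k = 0\<close>.
\<close>

lemma (in cring) pow_char_power_idempotent:
  fixes s :: nat
  assumes M: "ideal M R" and nil: "ideal_power R M k = {\<zero>}" and k: "0 < k"
    and s: "[s] \<cdot> \<one> \<in> M"
    and f: "f \<in> carrier R" and ff: "f \<otimes> f \<ominus> f \<in> M"
  shows "f [^] (s ^ (k - 1)) \<in> idempotents R"
proof -
  have "(f \<otimes> f) [^] (s ^ i) \<ominus> f [^] (s ^ i) \<in> ideal_power R M (Suc i)" for i
  proof (induction i)
    case 0
    then show ?case using f ff ideal_subset_ideal_power_one[OF M] by (auto simp: power_0)
  next
    case (Suc i)
    show ?case
      using pow_char_diff_mem_ideal_power[OF M s _ _ Suc] f by (simp add: nat_pow_pow mult.commute)
  qed
  from this[of "k - 1"] k nil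
  have "(f \<otimes> f) [^] (s ^ (k - 1)) \<ominus> f [^] (s ^ (k - 1)) = \<zero>" by simp
  then show ?thesis
    using f by (simp add: idempotents_def nat_pow_distrib eq_of_diff_eq_zero)
qed

section \<open>Idempotents modulo a nil ideal\<close>

lemma (in cring) idempotent_pow:
  assumes "e \<in> idempotents R" shows "e [^] Suc n = e"
  using assms by (induction n) (auto simp: idempotents_def)

lemma (in cring) idempotent_complement:
  assumes "e \<in> idempotents R" shows "\<one> \<ominus> e \<in> idempotents R"
proof -
  have e: "e \<in> carrier R" "e \<otimes> e = e" using assms by (auto simp: idempotents_def)
  have "(\<one> \<ominus> e) \<otimes> (\<one> \<ominus> e) = \<one> \<ominus> e \<ominus> e \<oplus> e \<otimes> e" using e(1) by algebra
  also have "\<dots> = \<one> \<ominus> e" unfolding e(2) using e(1) by algebra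
  finally show ?thesis using e by (simp add: idempotents_def)
qed

text \<open>
  The constant term of \<open>1 - (1 - a) ^ n\<close>, as a polynomial in \<open>a\<close>, is zero.
\<close>

lemma (in cring) dvd_one_minus_pow_one_minus:
  assumes "a \<in> carrier R"
  shows "\<exists>c\<in>carrier R. \<one> \<ominus> (\<one> \<ominus> a) [^] (n::nat) = a \<otimes> c"
proof (induction n)
  case 0
  show ?case by (rule bexI[of _ \<zero>]) (use assms in \<open>auto simp: a_minus_def r_neg\<close>)
next
  case (Suc n)
  then obtain c where c: "c \<in> carrier R" "\<one> \<ominus> (\<one> \<ominus> a) [^] n = a \<otimes> c" by blast
  have p: "(\<one> \<ominus> a) [^] n \<in> carrier R" using assms by simp
  have "\<one> \<ominus> (\<one> \<ominus> a) [^] Suc n = \<one> \<ominus> (\<one> \<ominus> a) [^] n \<oplus> a \<otimes> (\<one> \<ominus> a) [^] n"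
    using p assms unfolding nat_pow_Suc by algebra
  also have "\<dots> = a \<otimes> (c \<oplus> (\<one> \<ominus> a) [^] n)" unfolding c(2) using p assms c(1) by algebra
  finally show ?case using c p by blast
qed

text \<open>
  The element \<open>e (e - e')\<close> equals \<open>e (1 - e')\<close>, which is idempotent, and it is nilpotent because
  \<open>e - e'\<close> is. An idempotent equals all its positive powers, so it vanishes.
\<close>

lemma (in cring) idempotent_eq_mult_of_nilpotent_diff:
  fixes n :: nat
  assumes e: "e \<in> idempotents R" and e': "e' \<in> idempotents R"
    and nil: "(e \<ominus> e') [^] n = \<zero>"
  shows "e = e \<otimes> e'"
proof -
  have eR: "e \<in> carrier R" "e \<otimes> e = e" and eR': "e' \<in> carrier R" "e' \<otimes> e' = e'"
    using e e' by (auto simp: idempotents_def)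
  let ?u = "e \<otimes> (e \<ominus> e')"
  have "?u = (e \<otimes> e) \<ominus> e \<otimes> e'" using eR(1) eR'(1) by algebra
  then have u: "?u = e \<ominus> e \<otimes> e'" by (simp only: eR)
  have "(e \<ominus> e \<otimes> e') \<otimes> (e \<ominus> e \<otimes> e')
      = e \<otimes> e \<ominus> (e \<otimes> e) \<otimes> e' \<ominus> (e \<otimes> e) \<otimes> e' \<oplus> (e \<otimes> e) \<otimes> (e' \<otimes> e')"
    using eR(1) eR'(1) by algebra
  also have "\<dots> = e \<ominus> e \<otimes> e' \<ominus> e \<otimes> e' \<oplus> e \<otimes> e'" by (simp only: eR eR')
  also have "\<dots> = e \<ominus> e \<otimes> e'" using eR(1) eR'(1) by algebra
  finally have "?u \<in> idempotents R" using eR(1) eR'(1) unfolding u by (simp add: idempotents_def)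
  then have "?u = ?u [^] Suc n" by (simp only: idempotent_pow)
  also have "\<dots> = e [^] Suc n \<otimes> (e \<ominus> e') [^] Suc n"
    using eR(1) eR'(1) by (simp only: nat_pow_distrib minus_closed)
  also have "\<dots> = \<zero>" using eR(1) eR'(1) nil by simp
  finally have "e \<ominus> e \<otimes> e' = \<zero>" by (simp only: u)
  then show ?thesis using eR eR' eq_of_diff_eq_zero by simp
qed

lemma (in cring) one_minus_one_minus: "a \<in> carrier R \<Longrightarrow> \<one> \<ominus> (\<one> \<ominus> a) = a"
  by algebra

lemma (in cring) idempotent_iff_mult_complement:
  "e \<in> idempotents R \<longleftrightarrow> e \<in> carrier R \<and> e \<otimes> (\<one> \<ominus> e) = \<zero>"
proof (cases "e \<in> carrier R")
  case True
  then have "e \<otimes> (\<one> \<ominus> e) = e \<ominus> e \<otimes> e" by algebra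
  moreover have "e \<ominus> e = \<zero>" using True by algebra
  ultimately show ?thesis
    using True eq_of_diff_eq_zero[of e "e \<otimes> e"] by (auto simp: idempotents_def)
qed (simp add: idempotents_def)

text \<open>
  Write \<open>a = f ^ n\<close> and \<open>e = 1 - (1 - a) ^ n\<close>. Then \<open>e\<close> is a multiple of \<open>f ^ n\<close>. Since \<open>1 - a\<close> is a
  multiple of \<open>1 - f\<close>, the complement \<open>1 - e = (1 - a) ^ n\<close> is a multiple of \<open>(1 - f) ^ n\<close>. So
  \<open>e (1 - e)\<close> is a multiple of \<open>(f (1 - f)) ^ n = 0\<close>.
\<close>

lemma (in cring) lift_is_idempotent:
  fixes n :: nat
  assumes f: "f \<in> carrier R" and nil: "(f \<otimes> (\<one> \<ominus> f)) [^] n = \<zero>"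
  shows "\<one> \<ominus> (\<one> \<ominus> f [^] n) [^] n \<in> idempotents R"
proof -
  have f': "\<one> \<ominus> f \<in> carrier R" using f by simp
  have orth: "f [^] n \<otimes> (\<one> \<ominus> f) [^] n = \<zero>"
    using nil nat_pow_distrib[OF f f'] by simp
  define a where "a = f [^] n"
  define e where "e = \<one> \<ominus> (\<one> \<ominus> a) [^] n"
  have a: "a \<in> carrier R" and e: "e \<in> carrier R" using f by (auto simp: a_def e_def)
  obtain c where c: "c \<in> carrier R" "e = a \<otimes> c"
    using dvd_one_minus_pow_one_minus[OF a] unfolding e_def by blast
  obtain d where d: "d \<in> carrier R" "\<one> \<ominus> a = (\<one> \<ominus> f) \<otimes> d"
    using dvd_one_minus_pow_one_minus[OF f', of n] unfolding a_def one_minus_one_minus[OF f] by blast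
  have "\<one> \<ominus> e = (\<one> \<ominus> a) [^] n"
    using a unfolding e_def by (simp add: one_minus_one_minus)
  then have e1: "\<one> \<ominus> e = (\<one> \<ominus> f) [^] n \<otimes> d [^] n"
    using nat_pow_distrib[OF f' d(1)] d(2) by simp
  have "e \<otimes> (\<one> \<ominus> e) = (a \<otimes> (\<one> \<ominus> f) [^] n) \<otimes> (c \<otimes> d [^] n)"
    unfolding e1 unfolding c(2) using a c(1) nat_pow_closed[OF d(1)] nat_pow_closed[OF f']
    by (simp add: m_ac)
  also have "\<dots> = \<zero>" using orth c(1) d(1) by (simp add: a_def)
  finally show ?thesis using e unfolding idempotent_iff_mult_complement a_def e_def by blast
qed

text \<open>
  Injectivity: for idempotents \<open>e\<close> and \<open>e'\<close> with the same image, both differences are nilpotent, so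
  each of \<open>e\<close> and \<open>e'\<close> equals the product \<open>e e'\<close>. Surjectivity: if \<open>f\<close> is any preimage of an
  idempotent \<open>p\<close>, then \<open>f (1 - f)\<close> is in the kernel, so \<open>f\<close> can be corrected to an idempotent by a
  polynomial that fixes every idempotent, in particular \<open>p\<close>.
\<close>

lemma (in ring_hom_cring) bij_betw_idempotents_of_nil_kernel:
  assumes surj: "h ` carrier R = carrier S"
    and nil: "\<And>x. x \<in> a_kernel R S h \<Longrightarrow> \<exists>n::nat. x [^] n = \<zero>"
  shows "bij_betw h (idempotents R) (idempotents S)"
proof (rule bij_betw_imageI)
  have ker: "x \<in> a_kernel R S h \<longleftrightarrow> x \<in> carrier R \<and> h x = \<zero>\<^bsub>S\<^esub>" for x
    unfolding a_kernel_def' by simp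
  have hm: "h (x \<ominus> y) = h x \<ominus>\<^bsub>S\<^esub> h y" if "x \<in> carrier R" "y \<in> carrier R" for x y
    using that by (simp add: a_minus_def)
  have hp: "h (x [^] n) = h x [^]\<^bsub>S\<^esub> n" if "x \<in> carrier R" for x and n :: nat
    using that by (induction n) simp_all
  show "inj_on h (idempotents R)"
  proof (rule inj_onI)
    fix e e' assume idem: "e \<in> idempotents R" "e' \<in> idempotents R" and eq: "h e = h e'"
    then have e: "e \<in> carrier R" "e \<otimes> e = e" and e': "e' \<in> carrier R" "e' \<otimes> e' = e'"
      by (auto simp: idempotents_def)
    have "h (e \<ominus> e') = \<zero>\<^bsub>S\<^esub>" "h (e' \<ominus> e) = \<zero>\<^bsub>S\<^esub>"
      using e e' eq by (simp_all add: hm a_minus_def S.r_neg)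
    with e e' obtain m n :: nat where "(e \<ominus> e') [^] m = \<zero>" "(e' \<ominus> e) [^] n = \<zero>"
      using nil[of "e \<ominus> e'"] nil[of "e' \<ominus> e"] by (auto simp: ker)
    then have "e = e \<otimes> e'" "e' = e' \<otimes> e"
      using idem R.idempotent_eq_mult_of_nilpotent_diff by blast+
    then show "e = e'" using e e' R.m_comm by simp
  qed
  show "h ` idempotents R = idempotents S"
  proof (intro subset_antisym subsetI)
    fix p assume "p \<in> h ` idempotents R"
    then obtain e where e: "e \<in> carrier R" "e \<otimes> e = e" "p = h e" by (auto simp: idempotents_def)
    then have "h e \<otimes>\<^bsub>S\<^esub> h e = h e" using hom_mult[of e e] by simp
    with e show "p \<in> idempotents S" by (simp add: idempotents_def)
  next
    fix p assume p: "p \<in> idempotents S"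
    then have pS: "p \<in> carrier S" by (simp add: idempotents_def)
    then have "p \<in> h ` carrier R" using surj by simp
    then obtain f where f: "f \<in> carrier R" "h f = p" by (metis imageE)
    have "h (f \<otimes> (\<one> \<ominus> f)) = \<zero>\<^bsub>S\<^esub>"
      using f p by (simp add: hm S.idempotent_iff_mult_complement)
    then obtain m :: nat where "(f \<otimes> (\<one> \<ominus> f)) [^] m = \<zero>"
      using nil[of "f \<otimes> (\<one> \<ominus> f)"] f by (auto simp: ker)
    \<comment> \<open>A positive exponent is needed so that \<open>p\<close> and \<open>1 - p\<close> equal their powers below.\<close>
    then have "(f \<otimes> (\<one> \<ominus> f)) [^] Suc m = \<zero>" using f by simp
    from R.lift_is_idempotent[OF f(1) this]
    have "\<one> \<ominus> (\<one> \<ominus> f [^] Suc m) [^] Suc m \<in> idempotents R" .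
    moreover have "h (\<one> \<ominus> (\<one> \<ominus> f [^] Suc m) [^] Suc m) = p"
    proof -
      have "h (\<one> \<ominus> (\<one> \<ominus> f [^] Suc m) [^] Suc m)
          = \<one>\<^bsub>S\<^esub> \<ominus>\<^bsub>S\<^esub> (\<one>\<^bsub>S\<^esub> \<ominus>\<^bsub>S\<^esub> p [^]\<^bsub>S\<^esub> Suc m) [^]\<^bsub>S\<^esub> Suc m"
        using f by (simp add: hm hp del: nat_pow_Suc S.nat_pow_Suc)
      also have "\<dots> = \<one>\<^bsub>S\<^esub> \<ominus>\<^bsub>S\<^esub> (\<one>\<^bsub>S\<^esub> \<ominus>\<^bsub>S\<^esub> p)"
        by (simp only: S.idempotent_pow[OF p] S.idempotent_pow[OF S.idempotent_complement[OF p]])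
      finally show ?thesis by (simp only: S.one_minus_one_minus[OF pS])
    qed
    ultimately show "p \<in> h ` idempotents R" by blast
  qed
qed

section \<open>Group rings of commutative groups over commutative rings\<close>

lemma (in abelian_monoid) finsum_swap:
  assumes "finite A" "finite B" and "\<And>x y. x \<in> A \<Longrightarrow> y \<in> B \<Longrightarrow> f x y \<in> carrier G"
  shows "(\<Oplus>x\<in>A. \<Oplus>y\<in>B. f x y) = (\<Oplus>y\<in>B. \<Oplus>x\<in>A. f x y)"
  using assms(1,3)
proof (induction A rule: finite_induct)
  case empty
  then show ?case by (simp add: finsum_zero)
next
  case (insert a A)
  have "(\<Oplus>y\<in>B. \<Oplus>x\<in>insert a A. f x y) = (\<Oplus>y\<in>B. f a y \<oplus> (\<Oplus>x\<in>A. f x y))"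
    using insert by (intro finsum_cong') (auto simp: Pi_iff intro!: finsum_closed)
  also have "\<dots> = (\<Oplus>y\<in>B. f a y) \<oplus> (\<Oplus>y\<in>B. \<Oplus>x\<in>A. f x y)"
    using insert by (intro finsum_addf) (auto simp: Pi_iff intro!: finsum_closed)
  finally show ?case
    using insert by (simp add: Pi_iff finsum_closed)
qed

lemma (in ideal) finsum_mem:
  assumes "\<And>x. x \<in> A \<Longrightarrow> f x \<in> I"
  shows "(\<Oplus>x\<in>A. f x) \<in> I"
  using assms
proof (induction A rule: infinite_finite_induct)
  case (insert a A)
  then show ?case using Icarr by (subst finsum_insert) (auto simp: Pi_iff intro!: a_closed)
qed (simp_all add: zero_closed)

locale comm_group_ring = R?: cring R + G: comm_group G
  for R (structure) and G :: "('g, 'n) monoid_scheme"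
begin

abbreviation RG where "RG \<equiv> group_ring R G"

abbreviation supp where "supp \<equiv> gr_support R G"

lemma carrier_iff:
  "f \<in> carrier RG \<longleftrightarrow> f \<in> extensional (carrier G) \<and> (\<forall>g\<in>carrier G. f g \<in> carrier R) \<and> finite (supp f)"
  by (auto simp: group_ring_def PiE_iff)

lemma coeff_closed: "f \<in> carrier RG \<Longrightarrow> g \<in> carrier G \<Longrightarrow> f g \<in> carrier R"
  by (simp add: carrier_iff)

lemma finite_supp: "f \<in> carrier RG \<Longrightarrow> finite (supp f)"
  by (simp add: carrier_iff)

lemma supp_subset: "supp f \<subseteq> carrier G"
  by (auto simp: gr_support_def)

lemma coeff_outside_supp: "g \<in> carrier G \<Longrightarrow> g \<notin> supp f \<Longrightarrow> f g = \<zero>"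
  by (auto simp: gr_support_def)

lemma carrier_eqI:
  assumes "f \<in> carrier RG" "h \<in> carrier RG" "\<And>g. g \<in> carrier G \<Longrightarrow> f g = h g"
  shows "f = h"
proof (rule extensionalityI[OF _ _ assms(3)])
  show "f \<in> extensional (carrier G)" "h \<in> extensional (carrier G)"
    using assms(1,2) unfolding carrier_iff by blast+
qed

lemma carrierI:
  assumes "\<And>g. g \<in> carrier G \<Longrightarrow> f g \<in> carrier R" "finite S" 
    and "\<And>g. g \<in> carrier G \<Longrightarrow> g \<notin> S \<Longrightarrow> f g = \<zero>"
  shows "(\<lambda>g\<in>carrier G. f g) \<in> carrier RG"
proof -
  have "supp (\<lambda>g\<in>carrier G. f g) \<subseteq> S" using assms(3) by (auto simp: gr_support_def)
  then have "finite (supp (\<lambda>g\<in>carrier G. f g))" using assms(2) by (rule finite_subset)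
  then show ?thesis using assms(1) by (simp add: carrier_iff)
qed

lemma add_coeff: "g \<in> carrier G \<Longrightarrow> (f \<oplus>\<^bsub>RG\<^esub> h) g = f g \<oplus> h g"
  by (simp add: group_ring_def)

lemma zero_coeff: "g \<in> carrier G \<Longrightarrow> \<zero>\<^bsub>RG\<^esub> g = \<zero>"
  by (simp add: group_ring_def)

lemma one_coeff: "g \<in> carrier G \<Longrightarrow> \<one>\<^bsub>RG\<^esub> g = (if g = \<one>\<^bsub>G\<^esub> then \<one> else \<zero>)"
  by (simp add: group_ring_def)

lemma mult_coeff_supp:
  "g \<in> carrier G \<Longrightarrow> (f \<otimes>\<^bsub>RG\<^esub> h) g = (\<Oplus>x\<in>supp f. f x \<otimes> h (inv\<^bsub>G\<^esub> x \<otimes>\<^bsub>G\<^esub> g))"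
  by (simp add: group_ring_def)

lemma mult_restrict: "(\<lambda>g\<in>carrier G. (f \<otimes>\<^bsub>RG\<^esub> h) g) = f \<otimes>\<^bsub>RG\<^esub> h"
  by (auto simp: group_ring_def)

lemma one_closed: "\<one>\<^bsub>RG\<^esub> \<in> carrier RG"
  unfolding group_ring_def monoid.simps
  by (rule carrierI[of _ "{\<one>\<^bsub>G\<^esub>}", unfolded group_ring_def]) auto

lemma zero_closed: "\<zero>\<^bsub>RG\<^esub> \<in> carrier RG"
  unfolding group_ring_def ring.simps
  by (rule carrierI[of _ "{}", unfolded group_ring_def]) auto

lemma add_closed:
  assumes "f \<in> carrier RG" "h \<in> carrier RG" shows "f \<oplus>\<^bsub>RG\<^esub> h \<in> carrier RG"
proof -
  have "(\<lambda>g\<in>carrier G. f g \<oplus> h g) \<in> carrier RG"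
    using assms by (intro carrierI[of _ "supp f \<union> supp h"]) (auto simp: coeff_outside_supp coeff_closed finite_supp)
  then show ?thesis by (simp add: group_ring_def)
qed

declare coeff_closed [simp] finite_supp [simp]

text \<open>
  The sum over the support of \<open>f\<close> may be extended to any larger finite subset of \<open>G\<close>. Products of different
  elements can then be compared over a common range of summation.
\<close>

lemma mult_coeff:
  assumes "f \<in> carrier RG" "h \<in> carrier RG" "g \<in> carrier G"
    and S: "finite S" "supp f \<subseteq> S" "S \<subseteq> carrier G"
  shows "(f \<otimes>\<^bsub>RG\<^esub> h) g = (\<Oplus>x\<in>S. f x \<otimes> h (inv\<^bsub>G\<^esub> x \<otimes>\<^bsub>G\<^esub> g))"
proof -
  have "(f \<otimes>\<^bsub>RG\<^esub> h) g = (\<Oplus>x\<in>supp f. f x \<otimes> h (inv\<^bsub>G\<^esub> x \<otimes>\<^bsub>G\<^esub> g))"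
    by (rule mult_coeff_supp[OF assms(3)])
  also have "\<dots> = (\<Oplus>x\<in>S. f x \<otimes> h (inv\<^bsub>G\<^esub> x \<otimes>\<^bsub>G\<^esub> g))"
    using assms by (intro R.add.finprod_mono_neutral_cong_left)
      (auto simp: coeff_outside_supp Pi_iff subset_iff)
  finally show ?thesis .
qed

lemma finsum_product_closed:
  assumes "f \<in> carrier RG" "h \<in> carrier RG" "g \<in> carrier G" "S \<subseteq> carrier G"
  shows "(\<Oplus>x\<in>S. f x \<otimes> h (inv\<^bsub>G\<^esub> x \<otimes>\<^bsub>G\<^esub> g)) \<in> carrier R"
  using assms by (intro finsum_closed) (auto simp: subset_iff)

definition supp_prod where "supp_prod f h = (\<lambda>(x, y). x \<otimes>\<^bsub>G\<^esub> y) ` (supp f \<times> supp h)"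

lemma mult_outside_supp_prod:
  assumes fh: "f \<in> carrier RG" "h \<in> carrier RG" and g: "g \<in> carrier G" "g \<notin> supp_prod f h"
  shows "(f \<otimes>\<^bsub>RG\<^esub> h) g = \<zero>"
proof -
  have "h (inv\<^bsub>G\<^esub> x \<otimes>\<^bsub>G\<^esub> g) = \<zero>" if "x \<in> supp f" for x
  proof (rule coeff_outside_supp)
    have x: "x \<in> carrier G" using that supp_subset by blast
    then show "inv\<^bsub>G\<^esub> x \<otimes>\<^bsub>G\<^esub> g \<in> carrier G" using g by simp
    have "x \<otimes>\<^bsub>G\<^esub> (inv\<^bsub>G\<^esub> x \<otimes>\<^bsub>G\<^esub> g) = g" using x g by (simp add: G.m_assoc[symmetric])
    then show "inv\<^bsub>G\<^esub> x \<otimes>\<^bsub>G\<^esub> g \<notin> supp h" using g that unfolding supp_prod_def by force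
  qed
  then show ?thesis
    using fh g supp_subset by (subst mult_coeff[of _ _ _ "supp f"])
      (auto intro!: R.add.finprod_one_eqI simp: subset_iff)
qed

lemma finite_supp_prod: "f \<in> carrier RG \<Longrightarrow> h \<in> carrier RG \<Longrightarrow> finite (supp_prod f h)"
  by (simp add: supp_prod_def)

lemma supp_prod_subset: "supp_prod f h \<subseteq> carrier G"
  using supp_subset by (auto simp: supp_prod_def subset_iff)

lemma mult_closed:
  assumes fh: "f \<in> carrier RG" "h \<in> carrier RG"
  shows "f \<otimes>\<^bsub>RG\<^esub> h \<in> carrier RG"
proof -
  have "(\<lambda>g\<in>carrier G. (f \<otimes>\<^bsub>RG\<^esub> h) g) \<in> carrier RG"
  proof (rule carrierI[OF _ finite_supp_prod[OF fh] mult_outside_supp_prod[OF fh]])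
    fix g assume "g \<in> carrier G"
    then show "(f \<otimes>\<^bsub>RG\<^esub> h) g \<in> carrier R"
      using mult_coeff[OF fh _ finite_supp[OF fh(1)] subset_refl supp_subset]
        finsum_product_closed[OF fh _ supp_subset] by simp
  qed
  then show ?thesis by (simp only: mult_restrict)
qed

lemma mult_comm:
  assumes fh: "f \<in> carrier RG" "h \<in> carrier RG"
  shows "f \<otimes>\<^bsub>RG\<^esub> h = h \<otimes>\<^bsub>RG\<^esub> f"
proof (rule carrier_eqI)
  fix g assume g: "g \<in> carrier G"
  \<comment> \<open>On a commutative group this is an involution. It exchanges the two factors of each decomposition
    of \<open>g\<close>, so it turns the sum for \<open>f h\<close> into the sum for \<open>h f\<close>; the range of summation has to
    cover the support of \<open>f\<close>, and its image the support of \<open>h\<close>.\<close>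
  define \<phi> where "\<phi> x = inv\<^bsub>G\<^esub> x \<otimes>\<^bsub>G\<^esub> g" for x
  have \<phi>c: "\<phi> x \<in> carrier G" if "x \<in> carrier G" for x using that g by (simp add: \<phi>_def)
  have \<phi>\<phi>: "\<phi> (\<phi> x) = x" if "x \<in> carrier G" for x
    using that g by (simp add: \<phi>_def G.inv_mult G.m_assoc)
  define T where "T = supp f \<union> \<phi> ` supp h"
  have T: "finite T" "supp f \<subseteq> T" "T \<subseteq> carrier G"
    using fh supp_subset \<phi>c by (auto simp: T_def)
  have "supp h \<subseteq> \<phi> ` T"
  proof
    fix z assume z: "z \<in> supp h"
    then have "z = \<phi> (\<phi> z)" using supp_subset \<phi>\<phi> by (metis subsetD)
    then show "z \<in> \<phi> ` T" using z unfolding T_def by blast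
  qed
  moreover have "\<phi> ` T \<subseteq> carrier G" using T \<phi>c by blast
  moreover have "inj_on \<phi> T" using T \<phi>\<phi> by (metis inj_onI subset_iff)
  ultimately have "(h \<otimes>\<^bsub>RG\<^esub> f) g = (\<Oplus>x\<in>T. h (\<phi> x) \<otimes> f (\<phi> (\<phi> x)))"
    using T fh g \<phi>c by (subst mult_coeff[of _ _ _ "\<phi> ` T"], simp_all add: \<phi>_def[symmetric])
      (subst finsum_reindex, auto simp: subset_iff)
  also have "\<dots> = (\<Oplus>x\<in>T. f x \<otimes> h (\<phi> x))"
    using T fh \<phi>c \<phi>\<phi> by (intro finsum_cong') (auto simp: subset_iff m_comm)
  also have "\<dots> = (f \<otimes>\<^bsub>RG\<^esub> h) g"
    using T fh g by (simp add: mult_coeff[of _ _ _ T] \<phi>_def)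
  finally show "(f \<otimes>\<^bsub>RG\<^esub> h) g = (h \<otimes>\<^bsub>RG\<^esub> f) g" by simp
qed (use fh mult_closed in auto)

text \<open>
  Expanding \<open>(f h) k\<close> at \<open>g\<close> gives a double sum over \<open>x\<close> in \<open>supp_prod f h\<close> and \<open>y\<close> in the support of
  \<open>f\<close>. After exchanging the two sums, the inner one over \<open>x\<close> becomes the coefficient of \<open>h k\<close> at
  \<open>inv y g\<close> by translating \<open>x\<close> to \<open>inv y x\<close>; the translated range covers the support of \<open>h\<close>.
\<close>

lemma mult_assoc:
  assumes f: "f \<in> carrier RG" and h: "h \<in> carrier RG" and k: "k \<in> carrier RG"
  shows "(f \<otimes>\<^bsub>RG\<^esub> h) \<otimes>\<^bsub>RG\<^esub> k = f \<otimes>\<^bsub>RG\<^esub> (h \<otimes>\<^bsub>RG\<^esub> k)"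
proof (rule carrier_eqI)
  fix g assume g: "g \<in> carrier G"
  let ?P = "supp_prod f h"
  have P: "finite ?P" "?P \<subseteq> carrier G" "supp (f \<otimes>\<^bsub>RG\<^esub> h) \<subseteq> ?P"
    using finite_supp_prod[OF f h] supp_prod_subset mult_outside_supp_prod[OF f h]
    unfolding gr_support_def by blast+
  have PG: "x \<in> carrier G" if "x \<in> ?P" for x using P that by blast
  have SG: "x \<in> carrier G" if "x \<in> supp f" for x using supp_subset that by blast
  let ?t = "\<lambda>x y. f y \<otimes> (h (inv\<^bsub>G\<^esub> y \<otimes>\<^bsub>G\<^esub> x) \<otimes> k (inv\<^bsub>G\<^esub> x \<otimes>\<^bsub>G\<^esub> g))"
  have t: "?t x y \<in> carrier R" if "x \<in> ?P" "y \<in> supp f" for x y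
    using that PG SG f h k g by simp
  have "((f \<otimes>\<^bsub>RG\<^esub> h) \<otimes>\<^bsub>RG\<^esub> k) g = (\<Oplus>x\<in>?P. (f \<otimes>\<^bsub>RG\<^esub> h) x \<otimes> k (inv\<^bsub>G\<^esub> x \<otimes>\<^bsub>G\<^esub> g))"
    using P f h k g by (simp add: mult_coeff[of _ _ _ ?P] mult_closed)
  also have "\<dots> = (\<Oplus>x\<in>?P. \<Oplus>y\<in>supp f. ?t x y)"
  proof (rule finsum_cong')
    fix x assume x: "x \<in> ?P"
    have "(f \<otimes>\<^bsub>RG\<^esub> h) x \<otimes> k (inv\<^bsub>G\<^esub> x \<otimes>\<^bsub>G\<^esub> g)
        = (\<Oplus>y\<in>supp f. f y \<otimes> h (inv\<^bsub>G\<^esub> y \<otimes>\<^bsub>G\<^esub> x)) \<otimes> k (inv\<^bsub>G\<^esub> x \<otimes>\<^bsub>G\<^esub> g)"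
      using mult_coeff[OF f h PG[OF x] finite_supp[OF f] subset_refl supp_subset] by simp
    also have "\<dots> = (\<Oplus>y\<in>supp f. (f y \<otimes> h (inv\<^bsub>G\<^esub> y \<otimes>\<^bsub>G\<^esub> x)) \<otimes> k (inv\<^bsub>G\<^esub> x \<otimes>\<^bsub>G\<^esub> g))"
      using f h k g PG[OF x] SG by (intro finsum_ldistr) auto
    also have "\<dots> = (\<Oplus>y\<in>supp f. ?t x y)"
      using f h k g PG[OF x] SG by (intro finsum_cong') (auto simp: m_assoc)
    finally show "(f \<otimes>\<^bsub>RG\<^esub> h) x \<otimes> k (inv\<^bsub>G\<^esub> x \<otimes>\<^bsub>G\<^esub> g) = (\<Oplus>y\<in>supp f. ?t x y)" .
  qed (use t in \<open>auto intro!: finsum_closed\<close>)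
  also have "\<dots> = (\<Oplus>y\<in>supp f. \<Oplus>x\<in>?P. ?t x y)"
    using P(1) f t by (intro finsum_swap) auto
  also have "\<dots> = (\<Oplus>y\<in>supp f. f y \<otimes> (h \<otimes>\<^bsub>RG\<^esub> k) (inv\<^bsub>G\<^esub> y \<otimes>\<^bsub>G\<^esub> g))"
  proof (rule finsum_cong')
    fix y assume y: "y \<in> supp f"
    let ?m = "\<lambda>x. inv\<^bsub>G\<^esub> y \<otimes>\<^bsub>G\<^esub> x"
    have yG: "y \<in> carrier G" using SG y .
    have inj: "inj_on ?m ?P" using PG yG by (auto intro!: inj_onI)
    have sub: "?m ` ?P \<subseteq> carrier G" using PG yG by auto
    have "supp h \<subseteq> ?m ` ?P"
    proof
      fix z assume z: "z \<in> supp h"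
      then have zG: "z \<in> carrier G" using supp_subset by blast
      have "z = ?m (y \<otimes>\<^bsub>G\<^esub> z)" using yG zG by (simp add: G.m_assoc[symmetric])
      then show "z \<in> ?m ` ?P" using y z by (auto simp: supp_prod_def)
    qed
    then have "(h \<otimes>\<^bsub>RG\<^esub> k) (?m g) = (\<Oplus>z\<in>?m ` ?P. h z \<otimes> k (inv\<^bsub>G\<^esub> z \<otimes>\<^bsub>G\<^esub> ?m g))"
      using P(1) sub h k g yG by (intro mult_coeff) auto
    also have "\<dots> = (\<Oplus>x\<in>?P. h (?m x) \<otimes> k (inv\<^bsub>G\<^esub> (?m x) \<otimes>\<^bsub>G\<^esub> ?m g))"
      using inj PG yG h k g by (intro finsum_reindex) auto
    also have "\<dots> = (\<Oplus>x\<in>?P. h (?m x) \<otimes> k (inv\<^bsub>G\<^esub> x \<otimes>\<^bsub>G\<^esub> g))"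
    proof (rule finsum_cong')
      fix x assume "x \<in> ?P"
      then have xG: "x \<in> carrier G" by (rule PG)
      have "inv\<^bsub>G\<^esub> (?m x) \<otimes>\<^bsub>G\<^esub> ?m g = inv\<^bsub>G\<^esub> x \<otimes>\<^bsub>G\<^esub> (y \<otimes>\<^bsub>G\<^esub> (inv\<^bsub>G\<^esub> y \<otimes>\<^bsub>G\<^esub> g))"
        using xG yG g by (simp add: G.inv_mult_group G.m_assoc)
      also have "\<dots> = inv\<^bsub>G\<^esub> x \<otimes>\<^bsub>G\<^esub> g" using yG g by (simp add: G.m_assoc[symmetric])
      finally show "h (?m x) \<otimes> k (inv\<^bsub>G\<^esub> (?m x) \<otimes>\<^bsub>G\<^esub> ?m g) = h (?m x) \<otimes> k (inv\<^bsub>G\<^esub> x \<otimes>\<^bsub>G\<^esub> g)"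
        by simp
    qed (use PG yG h k g in auto)
    finally show "(\<Oplus>x\<in>?P. ?t x y) = f y \<otimes> (h \<otimes>\<^bsub>RG\<^esub> k) (?m g)"
      using PG yG f h k g by (simp add: finsum_rdistr[symmetric] P(1) Pi_iff)
  qed (use f g SG coeff_closed[OF mult_closed[OF h k]] in auto)
  also have "\<dots> = (f \<otimes>\<^bsub>RG\<^esub> (h \<otimes>\<^bsub>RG\<^esub> k)) g"
    using mult_coeff[OF f mult_closed[OF h k] g finite_supp[OF f] subset_refl supp_subset] by simp
  finally show "((f \<otimes>\<^bsub>RG\<^esub> h) \<otimes>\<^bsub>RG\<^esub> k) g = (f \<otimes>\<^bsub>RG\<^esub> (h \<otimes>\<^bsub>RG\<^esub> k)) g" .
qed (use assms mult_closed in auto)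

lemma one_mult:
  assumes "f \<in> carrier RG" shows "\<one>\<^bsub>RG\<^esub> \<otimes>\<^bsub>RG\<^esub> f = f"
proof (rule carrier_eqI)
  fix g assume g: "g \<in> carrier G"
  have "supp \<one>\<^bsub>RG\<^esub> \<subseteq> {\<one>\<^bsub>G\<^esub>}" by (auto simp: gr_support_def one_coeff split: if_splits)
  then have "(\<one>\<^bsub>RG\<^esub> \<otimes>\<^bsub>RG\<^esub> f) g = (\<Oplus>x\<in>{\<one>\<^bsub>G\<^esub>}. \<one>\<^bsub>RG\<^esub> x \<otimes> f (inv\<^bsub>G\<^esub> x \<otimes>\<^bsub>G\<^esub> g))"
    using assms g one_closed by (intro mult_coeff) auto
  then show "(\<one>\<^bsub>RG\<^esub> \<otimes>\<^bsub>RG\<^esub> f) g = f g" using assms g by (simp add: one_coeff)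
qed (use assms mult_closed one_closed in auto)

lemma add_mult_distrib:
  assumes f: "f \<in> carrier RG" and h: "h \<in> carrier RG" and k: "k \<in> carrier RG"
  shows "(f \<oplus>\<^bsub>RG\<^esub> h) \<otimes>\<^bsub>RG\<^esub> k = f \<otimes>\<^bsub>RG\<^esub> k \<oplus>\<^bsub>RG\<^esub> h \<otimes>\<^bsub>RG\<^esub> k"
proof (rule carrier_eqI)
  fix g assume g: "g \<in> carrier G"
  let ?S = "supp f \<union> supp h"
  have S: "finite ?S" "?S \<subseteq> carrier G" using f h supp_subset by auto
  have SG: "x \<in> carrier G" if "x \<in> ?S" for x using S that by blast
  have "supp (f \<oplus>\<^bsub>RG\<^esub> h) \<subseteq> ?S" by (auto simp: gr_support_def add_coeff)
  then have "((f \<oplus>\<^bsub>RG\<^esub> h) \<otimes>\<^bsub>RG\<^esub> k) g = (\<Oplus>x\<in>?S. (f \<oplus>\<^bsub>RG\<^esub> h) x \<otimes> k (inv\<^bsub>G\<^esub> x \<otimes>\<^bsub>G\<^esub> g))"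
    using f h k g S add_closed by (intro mult_coeff) auto
  also have "\<dots> = (\<Oplus>x\<in>?S. f x \<otimes> k (inv\<^bsub>G\<^esub> x \<otimes>\<^bsub>G\<^esub> g) \<oplus> h x \<otimes> k (inv\<^bsub>G\<^esub> x \<otimes>\<^bsub>G\<^esub> g))"
    using f h k g SG by (intro finsum_cong') (auto simp: add_coeff l_distr)
  also have "\<dots> = (\<Oplus>x\<in>?S. f x \<otimes> k (inv\<^bsub>G\<^esub> x \<otimes>\<^bsub>G\<^esub> g)) \<oplus> (\<Oplus>x\<in>?S. h x \<otimes> k (inv\<^bsub>G\<^esub> x \<otimes>\<^bsub>G\<^esub> g))"
    using f h k g SG by (intro finsum_addf) auto
  also have "\<dots> = (f \<otimes>\<^bsub>RG\<^esub> k) g \<oplus> (h \<otimes>\<^bsub>RG\<^esub> k) g"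
    using f h k g S by (simp add: mult_coeff[of _ _ _ ?S])
  finally show "((f \<oplus>\<^bsub>RG\<^esub> h) \<otimes>\<^bsub>RG\<^esub> k) g = (f \<otimes>\<^bsub>RG\<^esub> k \<oplus>\<^bsub>RG\<^esub> h \<otimes>\<^bsub>RG\<^esub> k) g"
    using g by (simp add: add_coeff)
qed (use assms mult_closed add_closed in auto)

lemma group_ring_cring: "cring RG"
proof (rule cringI)
  show "abelian_group RG"
  proof (rule abelian_groupI)
    fix f assume f: "f \<in> carrier RG"
    let ?m = "\<lambda>g\<in>carrier G. \<ominus> f g"
    have m: "?m \<in> carrier RG"
      using f by (intro carrierI[of _ "supp f"]) (auto simp: coeff_outside_supp)
    have "?m \<oplus>\<^bsub>RG\<^esub> f = \<zero>\<^bsub>RG\<^esub>"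
      using f m by (intro carrier_eqI) (auto simp: add_closed zero_closed add_coeff zero_coeff l_neg)
    with m show "\<exists>h\<in>carrier RG. h \<oplus>\<^bsub>RG\<^esub> f = \<zero>\<^bsub>RG\<^esub>" by blast
    show "\<zero>\<^bsub>RG\<^esub> \<oplus>\<^bsub>RG\<^esub> f = f"
      using f by (intro carrier_eqI) (auto simp: add_closed zero_closed add_coeff zero_coeff)
    fix h assume h: "h \<in> carrier RG"
    show "f \<oplus>\<^bsub>RG\<^esub> h = h \<oplus>\<^bsub>RG\<^esub> f"
      using f h by (intro carrier_eqI) (auto simp: add_closed add_coeff a_comm)
    fix k assume k: "k \<in> carrier RG"
    show "f \<oplus>\<^bsub>RG\<^esub> h \<oplus>\<^bsub>RG\<^esub> k = f \<oplus>\<^bsub>RG\<^esub> (h \<oplus>\<^bsub>RG\<^esub> k)"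
      using f h k by (intro carrier_eqI) (auto simp: add_closed add_coeff a_assoc)
  qed (auto intro: add_closed zero_closed)
  show "comm_monoid RG"
    by (rule comm_monoidI) (auto intro: mult_closed one_closed mult_assoc one_mult mult_comm)
qed (rule add_mult_distrib)

section \<open>Reduction of coefficients\<close>

lemma map_coeffs_ring_hom:
  assumes "ring_hom_cring R S \<phi>"
  shows "ring_hom_cring RG (group_ring S G) (\<lambda>f. \<lambda>g\<in>carrier G. \<phi> (f g))"
proof -
  interpret \<phi>: ring_hom_cring R S \<phi> by fact
  interpret S: comm_group_ring S G ..
  let ?h = "\<lambda>f. \<lambda>g\<in>carrier G. \<phi> (f g)"
  have supp: "S.supp (?h f) \<subseteq> supp f" for f by (auto simp: gr_support_def)
  have cl: "?h f \<in> carrier (group_ring S G)" if "f \<in> carrier RG" for f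
    using that by (intro S.carrierI[of _ "supp f"]) (auto simp: coeff_outside_supp)
  have "?h \<in> ring_hom RG (group_ring S G)"
  proof (rule ring_hom_memI)
    fix f assume f: "f \<in> carrier RG"
    show "?h f \<in> carrier (group_ring S G)" by (rule cl[OF f])
    fix k assume k: "k \<in> carrier RG"
    show "?h (f \<oplus>\<^bsub>RG\<^esub> k) = ?h f \<oplus>\<^bsub>group_ring S G\<^esub> ?h k"
      using f k by (intro S.carrier_eqI) (auto simp: cl add_closed S.add_closed add_coeff S.add_coeff)
    show "?h (f \<otimes>\<^bsub>RG\<^esub> k) = ?h f \<otimes>\<^bsub>group_ring S G\<^esub> ?h k"
    proof (rule S.carrier_eqI)
      fix g assume g: "g \<in> carrier G"
      have SG: "x \<in> carrier G" if "x \<in> supp f" for x using that supp_subset by blast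
      have "?h (f \<otimes>\<^bsub>RG\<^esub> k) g = \<phi> (\<Oplus>x\<in>supp f. f x \<otimes> k (inv\<^bsub>G\<^esub> x \<otimes>\<^bsub>G\<^esub> g))"
        using g mult_coeff[OF f k g finite_supp[OF f] subset_refl supp_subset] by simp
      also have "\<dots> = (\<Oplus>\<^bsub>S\<^esub>x\<in>supp f. \<phi> (f x \<otimes> k (inv\<^bsub>G\<^esub> x \<otimes>\<^bsub>G\<^esub> g)))"
        using f k g SG by (subst \<phi>.hom_finsum) (auto simp: comp_def)
      also have "\<dots> = (\<Oplus>\<^bsub>S\<^esub>x\<in>supp f. ?h f x \<otimes>\<^bsub>S\<^esub> ?h k (inv\<^bsub>G\<^esub> x \<otimes>\<^bsub>G\<^esub> g))"
        using f k g SG by (intro \<phi>.S.finsum_cong') auto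
      also have "\<dots> = (?h f \<otimes>\<^bsub>group_ring S G\<^esub> ?h k) g"
        using S.mult_coeff[OF cl[OF f] cl[OF k] g finite_supp[OF f] supp supp_subset] by simp
      finally show "?h (f \<otimes>\<^bsub>RG\<^esub> k) g = (?h f \<otimes>\<^bsub>group_ring S G\<^esub> ?h k) g" .
    qed (use f k in \<open>auto simp: cl mult_closed S.mult_closed\<close>)
  next
    show "?h \<one>\<^bsub>RG\<^esub> = \<one>\<^bsub>group_ring S G\<^esub>"
      by (intro S.carrier_eqI) (auto simp: cl one_closed S.one_closed one_coeff S.one_coeff)
  qed
  then show ?thesis
    by (intro ring_hom_cring.intro ring_hom_cring_axioms.intro group_ring_cring S.group_ring_cring)
qed

lemma reduce_coeffs_ring_hom:
  assumes "ideal N R"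
  shows "ring_hom_cring RG (group_ring (R Quot N) G) (reduce_coeffs R G N)"
proof -
  have "reduce_coeffs R G N = (\<lambda>f. \<lambda>g\<in>carrier G. N +>\<^bsub>R\<^esub> f g)"
    by (auto simp: reduce_coeffs_def)
  then show ?thesis
    using map_coeffs_ring_hom[OF ideal.rcos_ring_hom_cring[OF assms R.is_cring]] by simp
qed

text \<open>
  Representatives of the coefficients are chosen with \<open>0\<close> representing the zero coset, so that the
  preimage again has finite support.
\<close>

lemma reduce_coeffs_surj:
  assumes N: "ideal N R"
  shows "reduce_coeffs R G N ` carrier RG = carrier (group_ring (R Quot N) G)"
proof (intro subset_antisym subsetI)
  interpret N: ideal N R by fact
  interpret Q: cring "R Quot N" by (rule N.quotient_is_cring[OF R.is_cring])
  interpret Q: comm_group_ring "R Quot N" G ..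
  {
    fix F assume "F \<in> reduce_coeffs R G N ` carrier RG"
    then show "F \<in> carrier (group_ring (R Quot N) G)"
      using ring_hom_closed[OF ring_hom_cring.homh[OF reduce_coeffs_ring_hom[OF N]]] by blast
  }
  fix F assume F: "F \<in> carrier (group_ring (R Quot N) G)"
  have zero: "\<zero>\<^bsub>R Quot N\<^esub> = N +>\<^bsub>R\<^esub> \<zero>"
    using ring_hom_cring.hom_zero[OF N.rcos_ring_hom_cring[OF R.is_cring]] by simp
  have "\<exists>a\<in>carrier R. N +>\<^bsub>R\<^esub> a = F g \<and> (F g = \<zero>\<^bsub>R Quot N\<^esub> \<longrightarrow> a = \<zero>)" if "g \<in> carrier G" for g
  proof (cases "F g = \<zero>\<^bsub>R Quot N\<^esub>")
    case False
    have "F g \<in> carrier (R Quot N)" using F that by simp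
    then show ?thesis using False by (auto simp: FactRing_def A_RCOSETS_def')
  qed (auto simp: zero)
  then obtain f where f: "\<And>g. g \<in> carrier G \<Longrightarrow> f g \<in> carrier R"
    "\<And>g. g \<in> carrier G \<Longrightarrow> N +>\<^bsub>R\<^esub> f g = F g"
    "\<And>g. g \<in> carrier G \<Longrightarrow> F g = \<zero>\<^bsub>R Quot N\<^esub> \<Longrightarrow> f g = \<zero>"
    by metis
  have "(\<lambda>g\<in>carrier G. f g) \<in> carrier RG"
    using f F Q.coeff_outside_supp by (intro carrierI[of _ "Q.supp F"]) auto
  moreover have "reduce_coeffs R G N (\<lambda>g\<in>carrier G. f g) = F"
  proof (rule extensionalityI)
    show "F \<in> extensional (carrier G)" using F unfolding Q.carrier_iff by blast
  qed (simp_all add: reduce_coeffs_def f(2))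
  ultimately show "F \<in> reduce_coeffs R G N ` carrier RG" by blast
qed

lemma coeff_ideal_is_ideal:
  assumes "ideal N R" shows "ideal (coeff_ideal R G N) RG"
proof -
  interpret \<rho>: ring_hom_cring RG "group_ring (R Quot N) G" "reduce_coeffs R G N"
    by (rule reduce_coeffs_ring_hom) fact
  show ?thesis using \<rho>.ring.kernel_is_ideal kernel_reduce_coeffs[OF assms, of G] by simp
qed

section \<open>Nilpotency of the ideal of elements with coefficients in an ideal\<close>

lemma mult_mem_coeff_ideal:
  assumes L: "ideal L R" and IJ: "\<And>a b. a \<in> I \<Longrightarrow> b \<in> J \<Longrightarrow> a \<otimes> b \<in> L"
    and f: "f \<in> coeff_ideal R G I" and h: "h \<in> coeff_ideal R G J"
  shows "f \<otimes>\<^bsub>RG\<^esub> h \<in> coeff_ideal R G L"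
proof -
  have fh: "f \<in> carrier RG" "h \<in> carrier RG" using f h unfolding coeff_ideal_def by blast+
  have "(f \<otimes>\<^bsub>RG\<^esub> h) g \<in> L" if g: "g \<in> carrier G" for g
    unfolding mult_coeff_supp[OF g]
  proof (rule ideal.finsum_mem[OF L])
    fix x assume "x \<in> supp f"
    then have "x \<in> carrier G" using supp_subset by blast
    moreover from this g have "inv\<^bsub>G\<^esub> x \<otimes>\<^bsub>G\<^esub> g \<in> carrier G" by simp
    ultimately show "f x \<otimes> h (inv\<^bsub>G\<^esub> x \<otimes>\<^bsub>G\<^esub> g) \<in> L"
      using IJ f h unfolding coeff_ideal_def by blast
  qed
  then show ?thesis using mult_closed[OF fh] unfolding coeff_ideal_def by blast
qed

text \<open>
  The right-hand side is an ideal of the group ring, and it contains every product of \<open>i\<close> elements with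
  coefficients in \<open>N\<close>, because the coefficients of such a product are sums of products of \<open>i\<close> elements
  of \<open>N\<close>.
\<close>

lemma ideal_power_coeff_ideal_subset:
  assumes N: "ideal N R"
  shows "ideal_power RG (coeff_ideal R G N) i \<subseteq> coeff_ideal R G (ideal_power R N i)"
proof -
  interpret RG: cring RG by (rule group_ring_cring)
  show ?thesis
  proof (rule RG.ideal_power_minimal[OF coeff_ideal_is_ideal[OF ideal_power_is_ideal[OF N]]])
    fix x assume "x \<in> {..<i} \<rightarrow> coeff_ideal R G N"
    then show "(\<Otimes>\<^bsub>RG\<^esub>j\<in>{..<i}. x j) \<in> coeff_ideal R G (ideal_power R N i)"
    proof (induction i)
      case 0
      have "\<one> \<in> ideal_power R N 0" using finprod_mem_ideal_power[OF N, of _ 0] by simp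
      moreover have "\<zero> \<in> ideal_power R N 0"
        by (rule additive_subgroup.zero_closed[OF ideal.axioms(1)[OF ideal_power_is_ideal[OF N]]])
      ultimately have "\<one>\<^bsub>RG\<^esub> \<in> coeff_ideal R G (ideal_power R N 0)"
        using one_closed by (auto simp: coeff_ideal_def one_coeff)
      then show ?case by simp
    next
      case (Suc i)
      have "x \<in> {..<Suc i} \<rightarrow> carrier RG" using Suc.prems unfolding coeff_ideal_def by blast
      then have "(\<Otimes>\<^bsub>RG\<^esub>j\<in>{..<Suc i}. x j) = x i \<otimes>\<^bsub>RG\<^esub> (\<Otimes>\<^bsub>RG\<^esub>j\<in>{..<i}. x j)"
        by (rule RG.finprod_lessThan_Suc)
      also have "\<dots> \<in> coeff_ideal R G (ideal_power R N (Suc i))"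
      proof (rule mult_mem_coeff_ideal[OF ideal_power_is_ideal[OF N] mult_mem_ideal_power_Suc[OF N]])
        show "x i \<in> coeff_ideal R G N" using Suc.prems by (simp add: Pi_iff)
        show "(\<Otimes>\<^bsub>RG\<^esub>j\<in>{..<i}. x j) \<in> coeff_ideal R G (ideal_power R N i)"
          using Suc by (simp add: Pi_iff)
      qed
      finally show ?case .
    qed
  qed
qed

lemma coeff_ideal_nilpotent:
  assumes N: "ideal N R" and nil: "ideal_power R N k = {\<zero>}"
  shows "ideal_power RG (coeff_ideal R G N) k = {\<zero>\<^bsub>RG\<^esub>}"
proof
  interpret RG: cring RG by (rule group_ring_cring)
  show "ideal_power RG (coeff_ideal R G N) k \<subseteq> {\<zero>\<^bsub>RG\<^esub>}"
  proof
    fix f assume "f \<in> ideal_power RG (coeff_ideal R G N) k"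
    then have f: "f \<in> carrier RG" "\<And>g. g \<in> carrier G \<Longrightarrow> f g = \<zero>"
      using ideal_power_coeff_ideal_subset[OF N] nil unfolding coeff_ideal_def by blast+
    have "f = \<zero>\<^bsub>RG\<^esub>"
      by (rule carrier_eqI[OF f(1) zero_closed]) (simp add: f(2) zero_coeff)
    then show "f \<in> {\<zero>\<^bsub>RG\<^esub>}" by simp
  qed
  interpret P: ideal "ideal_power RG (coeff_ideal R G N) k" RG
    by (rule RG.ideal_power_is_ideal[OF coeff_ideal_is_ideal[OF N]])
  show "{\<zero>\<^bsub>RG\<^esub>} \<subseteq> ideal_power RG (coeff_ideal R G N) k" using P.zero_closed by simp
qed

lemma add_pow_coeff:
  fixes n :: nat
  assumes "f \<in> carrier RG" "g \<in> carrier G"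
  shows "([n] \<cdot>\<^bsub>RG\<^esub> f) g = [n] \<cdot> (f g)"
proof -
  interpret RG: cring RG by (rule group_ring_cring)
  show ?thesis using assms by (induction n) (simp_all add: zero_coeff add_coeff)
qed

lemma add_pow_one_mem_coeff_ideal:
  fixes n :: nat
  assumes N: "ideal N R" and n: "[n] \<cdot> \<one> \<in> N"
  shows "[n] \<cdot>\<^bsub>RG\<^esub> \<one>\<^bsub>RG\<^esub> \<in> coeff_ideal R G N"
proof -
  interpret RG: cring RG by (rule group_ring_cring)
  have "([n] \<cdot>\<^bsub>RG\<^esub> \<one>\<^bsub>RG\<^esub>) g \<in> N" if "g \<in> carrier G" for g
    using that n additive_subgroup.zero_closed[OF ideal.axioms(1)[OF N]]
    by (simp add: add_pow_coeff one_closed one_coeff)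
  moreover have "[n] \<cdot>\<^bsub>RG\<^esub> \<one>\<^bsub>RG\<^esub> \<in> carrier RG" by simp
  ultimately show ?thesis unfolding coeff_ideal_def by blast
qed

end

section \<open>The characteristic and the idempotents of the group ring\<close>

lemma (in ring) ring_characteristic_add_pow_one: "[ring_characteristic R] \<cdot> \<one> = \<zero>"
proof (cases "\<exists>n::nat. 0 < n \<and> [n] \<cdot> \<one> = \<zero>")
  case True
  from LeastI_ex[OF this] True show ?thesis by (simp add: ring_characteristic_def)
next
  case False
  then have "ring_characteristic R = 0" unfolding ring_characteristic_def by (rule if_not_P)
  then show ?thesis by simp
qed

lemma (in ring_hom_cring) hom_add_pow:
  fixes n :: nat
  shows "x \<in> carrier R \<Longrightarrow> h ([n] \<cdot> x) = [n] \<cdot>\<^bsub>S\<^esub> h x"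
  by (induction n) simp_all

lemma (in cring) ring_characteristic_Quot_mem:
  assumes N: "ideal N R"
  shows "[ring_characteristic (R Quot N)] \<cdot> \<one> \<in> N"
proof -
  interpret N: ideal N R by fact
  have zero: "\<zero>\<^bsub>R Quot N\<^esub> = N" by (simp add: FactRing_def)
  interpret q: ring_hom_cring R "R Quot N" "(+>) N"
    by (rule N.rcos_ring_hom_cring[OF is_cring])
  let ?s = "ring_characteristic (R Quot N)"
  have "N +> ([?s] \<cdot> \<one>) = [?s] \<cdot>\<^bsub>R Quot N\<^esub> (N +> \<one>)" by (rule q.hom_add_pow) simp
  also have "\<dots> = \<zero>\<^bsub>R Quot N\<^esub>"
    using q.S.ring_characteristic_add_pow_one q.hom_one by simp
  also have "\<dots> = N" by (rule zero)
  finally show ?thesis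
    using N.a_rcos_self[of "[?s] \<cdot> \<one>"] by simp
qed

theorem corollary4p5:
  fixes R :: "('a, 'm) ring_scheme" and G :: "('g, 'n) monoid_scheme"
    and N :: "'a set" and k s :: nat
  assumes "cring R"
    and "ideal N R"
    and "nilpotent_of_index R N k"
    and "comm_group G"
    and "s = ring_characteristic (R Quot N)"
  shows "(\<forall>f \<in> carrier (group_ring R G).
            reduce_coeffs R G N f \<in> idempotents (group_ring (R Quot N) G) \<longrightarrow>
            f [^]\<^bsub>group_ring R G\<^esub> (s ^ (k - 1)) \<in> idempotents (group_ring R G)) \<and>
         idempotents (group_ring R G) \<approx> idempotents (group_ring (R Quot N) G)"
proof -
  interpret R: cring R by fact
  interpret G: comm_group G by fact
  interpret RG: comm_group_ring R G ..
  interpret \<rho>: ring_hom_cring "group_ring R G" "group_ring (R Quot N) G" "reduce_coeffs R G N"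
    by (rule RG.reduce_coeffs_ring_hom) fact
  have k: "0 < k" and nil: "ideal_power R N k = {\<zero>\<^bsub>R\<^esub>}"
    using assms(3) unfolding nilpotent_of_index_def by auto
  note M = RG.coeff_ideal_is_ideal[OF assms(2)]
  note nil' = RG.coeff_ideal_nilpotent[OF assms(2) nil]
  note ker = kernel_reduce_coeffs[OF assms(2), of G]
  show ?thesis
  proof (intro conjI ballI impI)
    fix f assume f: "f \<in> carrier (group_ring R G)"
      and idem: "reduce_coeffs R G N f \<in> idempotents (group_ring (R Quot N) G)"
    let ?d = "f \<otimes>\<^bsub>group_ring R G\<^esub> f \<ominus>\<^bsub>group_ring R G\<^esub> f"
    have "reduce_coeffs R G N ?d = \<zero>\<^bsub>group_ring (R Quot N) G\<^esub>"
      using f idem by (simp add: a_minus_def idempotents_def \<rho>.S.r_neg)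
    then have "?d \<in> coeff_ideal R G N"
      using f unfolding ker[symmetric] a_kernel_def' by simp
    then show "f [^]\<^bsub>group_ring R G\<^esub> (s ^ (k - 1)) \<in> idempotents (group_ring R G)"
      using \<rho>.R.pow_char_power_idempotent[OF M nil' k _ f]
        RG.add_pow_one_mem_coeff_ideal[OF assms(2)] R.ring_characteristic_Quot_mem[OF assms(2)]
      unfolding assms(5) by blast
  next
    have "bij_betw (reduce_coeffs R G N) (idempotents (group_ring R G))
        (idempotents (group_ring (R Quot N) G))"
    proof (rule \<rho>.bij_betw_idempotents_of_nil_kernel[OF RG.reduce_coeffs_surj[OF assms(2)]])
      fix x assume "x \<in> a_kernel (group_ring R G) (group_ring (R Quot N) G) (reduce_coeffs R G N)"
      then have "x [^]\<^bsub>group_ring R G\<^esub> k \<in> ideal_power (group_ring R G) (coeff_ideal R G N) k"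
        unfolding ker by (rule \<rho>.R.pow_mem_ideal_power[OF M])
      then show "\<exists>n::nat. x [^]\<^bsub>group_ring R G\<^esub> n = \<zero>\<^bsub>group_ring R G\<^esub>"
        unfolding nil' by blast
    qed
    then show "idempotents (group_ring R G) \<approx> idempotents (group_ring (R Quot N) G)"
      unfolding eqpoll_def by blast
  qed
qed

end
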